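(* Let $C\subset\mathbb{R}^n$ be a closed convex set and let $f:\mathbb{R}^n\to\mathbb{R}$ be continuously differentiable. Assume that there is $L>0$ with $\|\nabla f(x)-\nabla f(y)\|\le L\|x-y\|$ for all $x,y\in C$, and that $\nabla f(x)\in \mathrm{int}(C_\infty)^*$ for all $x\in C$. Let $(x^k)_{k\in\mathbb{N}}\subset C$ be an infinite sequence generated by the Frank--Wolfe algorithm for minimizing $f$ over $C$ (with the step size using this $L$, as described in the context), started from a point $x^0\in C$. Then: (i) If $f$ is convex on $C$ and $x^*$ is a cluster point of $(x^k)_{k\in\mathbb{N}}$, then $x^*$ is a solution of the problem of minimizing $f$ over $C$, i.e. $x^*\in C$ and $f(x^* )\le f(x)$ for all $x\in C$. (ii) If $f$ is $M$-strongly convex on $C$ for some $M>0$, then $(x^k)_{k\in\mathbb{N}}$ converges to a point $x^*\in C$ that is a solution of the problem of minimizing $f$ over $C$. Moreover, $\|x^k-x^*\|\le\sqrt{2(f(x^k)-f(x^* ))/M}$ for all $k=0,1,\ldots$.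
   Context: $\|\cdot\|$ is the Euclidean norm on $\mathbb{R}^n$. For a closed convex set $C\subset\mathbb{R}^n$, the asymptotic cone is $C_\infty:=\{d\in\mathbb{R}^n:\ x+td\in C\ \ \forall x\in C,\ \forall t\ge 0\}$ (equivalently, the set of all $d=\lim_k t_k x^k$ with $x^k\in C$, $t_k>0$, $t_k\to 0$), and $\mathrm{int}(C_\infty)^*:=\{x\in\mathbb{R}^n:\ x^Ty>0\ \ \forall y\in C_\infty\setminus\{0\}\}$ is the interior of the positive dual cone of $C_\infty$. A function $f$ is $M$-strongly convex on $C$ if $f(tx+(1-t)y)\le tf(x)+(1-t)f(y)-\frac{1}{2}Mt(1-t)\|y-x\|^2$ for all $t\in[0,1]$ and $x,y\in C$; it is convex on $C$ if this holds with $M=0$. Frank--Wolfe algorithm: choose $x^0\in C$. Given $x^k\in C$, choose any $p^k\in\operatorname{argmin}_{p\in C}\nabla f(x^k)^T(p-x^k)$ and set $v_k^*:=\nabla f(x^k)^T(p^k-x^k)$. If $v_k^*=0$, stop. Otherwise set $\lambda_k:=\min\{1,\ |v_k^*|/(L\|p^k-x^k\|^2)\}$ and $x^{k+1}:=x^k+\lambda_k(p^k-x^k)$. Under the stated assumptions the argmin is nonempty for every $x^k\in C$. The generated sequence is infinite when the algorithm never stops, i.e. $v_k^*\ne 0$ for all $k$. *)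

theory Defs
  imports "HOL-Analysis.Analysis"
begin

(* Intended for closed convex nonempty C. *)
definition asymptotic_cone :: "(real ^ 'n) set \<Rightarrow> (real ^ 'n) set" where
  "asymptotic_cone C = {d. \<forall>x\<in>C. \<forall>t\<ge>0. x + t *\<^sub>R d \<in> C}"

(* For a closed cone K this is the topological interior of the positive dual cone of K. *)
definition int_dual_cone :: "(real ^ 'n) set \<Rightarrow> (real ^ 'n) set" where
  "int_dual_cone K = {x. \<forall>y\<in>K - {0}. x \<bullet> y > 0}"

definition strongly_convex_on :: "real \<Rightarrow> (real ^ 'n) set \<Rightarrow> (real ^ 'n \<Rightarrow> real) \<Rightarrow> bool" where
  "strongly_convex_on M C f \<longleftrightarrow>
     (\<forall>x\<in>C. \<forall>y\<in>C. \<forall>t\<in>{0..1}.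
        f (t *\<^sub>R x + (1 - t) *\<^sub>R y)
          \<le> t * f x + (1 - t) * f y - 1/2 * M * t * (1 - t) * (norm (y - x))\<^sup>2)"

definition cluster_point :: "(nat \<Rightarrow> real ^ 'n) \<Rightarrow> real ^ 'n \<Rightarrow> bool" where
  "cluster_point x a \<longleftrightarrow> (\<exists>r. strict_mono r \<and> (x \<circ> r) \<longlonglongrightarrow> a)"

definition minimizer_on :: "(real ^ 'n) set \<Rightarrow> (real ^ 'n \<Rightarrow> real) \<Rightarrow> real ^ 'n \<Rightarrow> bool" where
  "minimizer_on C f a \<longleftrightarrow> a \<in> C \<and> (\<forall>x\<in>C. f a \<le> f x)"

(* One non-stopping iteration from x to x', where g is the gradient of the objective.
   The minimizer p of the linearized problem need not be unique; any choice is allowed. *)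
definition frank_wolfe_step ::
  "(real ^ 'n) set \<Rightarrow> (real ^ 'n \<Rightarrow> real ^ 'n) \<Rightarrow> real \<Rightarrow> real ^ 'n \<Rightarrow> real ^ 'n \<Rightarrow> bool" where
  "frank_wolfe_step C g L x x' \<longleftrightarrow>
     (\<exists>p. minimizer_on C (\<lambda>q. g x \<bullet> (q - x)) p \<and>
          (let v = g x \<bullet> (p - x);
               s = min 1 (\<bar>v\<bar> / (L * (norm (p - x))\<^sup>2))
           in v \<noteq> 0 \<and> x' = x + s *\<^sub>R (p - x)))"

(* Iterates of a run that never stops. All of them lie in C, since C is convex and each
   step moves along the segment from x k to a point of C. *)
definition frank_wolfe_sequence ::
  "(real ^ 'n) set \<Rightarrow> (real ^ 'n \<Rightarrow> real ^ 'n) \<Rightarrow> real \<Rightarrow> (nat \<Rightarrow> real ^ 'n) \<Rightarrow> bool" where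
  "frank_wolfe_sequence C g L x \<longleftrightarrow>
     x 0 \<in> C \<and> (\<forall>k. frank_wolfe_step C g L (x k) (x (Suc k)))"

end

theory Submission
  imports Defs
begin

text \<open>
  A step of length \<open>\<lambda>\<close> with gap \<open>v\<close> decreases \<open>f\<close> by at least
  \<open>min v (v\<^sup>2 / (L \<parallel>p - x\<parallel>\<^sup>2)) / 2\<close>, and \<open>f\<close> converges along a run that has a cluster point \<open>a\<close>.
  Along a subsequence tending to \<open>a\<close> the points \<open>p\<close> stay bounded: otherwise their normalized
  directions accumulate at a unit vector \<open>d\<close> of the asymptotic cone with \<open>\<nabla>f(a) \<bullet> d \<le> 0\<close>.
  Hence the gaps tend to \<open>0\<close> there, which gives the first-order optimality condition at \<open>a\<close>.
  Under strong convexity sublevel sets are bounded, so a cluster point exists, and quadratic growth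
  around the minimizer upgrades \<open>f(x\<^sub>k) \<rightarrow> f(a)\<close> to convergence of the whole sequence.
\<close>

section \<open>Recession directions and boundedness of linear sublevel sets\<close>

text \<open>Put weight \<open>t / norm (q n)\<close> on \<open>q n\<close> and the rest on
  \<open>z\<close>. The weight vanishes, so \<open>z\<close> survives with coefficient 1, while the
  part from \<open>q n\<close> tends to \<open>t *\<^sub>R d\<close>. Closedness keeps the limit in
  \<open>C\<close>.\<close>

lemma seq_unbounded_direction_in_asymptotic_cone:
  fixes q :: "nat \<Rightarrow> real ^ 'n"
  assumes "closed C" "convex C" and qC: "\<And>n. q n \<in> C"
    and qinf: "filterlim (\<lambda>n. norm (q n)) at_top sequentially"
    and lim: "(\<lambda>n. q n /\<^sub>R norm (q n)) \<longlonglongrightarrow> d"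
  shows "d \<in> asymptotic_cone C"
  unfolding asymptotic_cone_def
proof (intro CollectI ballI allI impI)
  fix z t assume z: "z \<in> C" and t: "(0::real) \<le> t"
  have inv: "(\<lambda>n. t / norm (q n)) \<longlonglongrightarrow> 0"
    by (rule tendsto_divide_0[OF tendsto_const filterlim_at_top_imp_at_infinity[OF qinf]])
  have "(\<lambda>n. (1 - t / norm (q n)) *\<^sub>R z + t *\<^sub>R (q n /\<^sub>R norm (q n))) \<longlonglongrightarrow> (1 - 0) *\<^sub>R z + t *\<^sub>R d"
    by (intro tendsto_intros inv lim)
  moreover have "\<forall>\<^sub>F n in sequentially.
      (1 - t / norm (q n)) *\<^sub>R z + t *\<^sub>R (q n /\<^sub>R norm (q n)) \<in> C"
    \<comment> \<open>Once the norm exceeds \<open>t\<close>, the weight is below 1 and the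
      combination is convex.\<close>
    using filterlim_at_top_dense[THEN iffD1, OF qinf, rule_format, of t]
  proof eventually_elim
    case (elim n)
    then have "(1 - t / norm (q n)) *\<^sub>R z + (t / norm (q n)) *\<^sub>R q n \<in> C"
      using t by (intro convexD[OF \<open>convex C\<close> z qC]) (auto simp: divide_simps)
    then show ?case by (simp add: divide_inverse)
  qed
  ultimately have "(1 - 0) *\<^sub>R z + t *\<^sub>R d \<in> C"
    by (intro Lim_in_closed_set[OF \<open>closed C\<close>]) auto
  then show "z + t *\<^sub>R d \<in> C" by simp
qed

text \<open>For a given height \<open>B\<close>, one radius \<open>D\<close> serves all functionals
  \<open>h\<close> near \<open>g\<close>; this uniformity is what lets it apply to gradients that
  vary along a subsequence. If it failed, dividing \<open>h n \<bullet> q n \<le> B\<close> by the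
  growing norms would give \<open>g \<bullet> d \<le> 0\<close> for a unit direction
  \<open>d\<close> of the asymptotic cone.\<close>

lemma int_dual_cone_sublevel_bounded:
  fixes g :: "real ^ 'n"
  assumes "closed C" "convex C" and g: "g \<in> int_dual_cone (asymptotic_cone C)"
  obtains e D where "e > 0"
    "\<And>h q. norm (h - g) < e \<Longrightarrow> q \<in> C \<Longrightarrow> h \<bullet> q \<le> B \<Longrightarrow> norm q \<le> D"
proof (rule ccontr)
  assume "\<not> thesis"
  with that have neg: "\<And>e D. e > 0 \<Longrightarrow>
      \<exists>h q. norm (h - g) < e \<and> q \<in> C \<and> h \<bullet> q \<le> B \<and> D < norm q"
    by (meson not_le)
  \<comment> \<open>Shrinking \<open>e\<close> and growing \<open>D\<close> together forces both
    \<open>h n\<close> to tend to \<open>g\<close> and the norms of \<open>q n\<close> to tend to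
    infinity.\<close>
  have "\<exists>h q. norm (h - g) < 1 / real (Suc n) \<and> q \<in> C \<and> h \<bullet> q \<le> B \<and> real (Suc n) < norm q" for n
    by (rule neg) simp
  then obtain h q where hq: "\<And>n. norm (h n - g) < 1 / real (Suc n)" "\<And>n. q n \<in> C"
      "\<And>n. h n \<bullet> q n \<le> B" "\<And>n. real (Suc n) < norm (q n)"
    by metis
  have qpos: "norm (q n) > 0" for n
    using hq(4)[of n] by linarith
  have hlim: "h \<longlonglongrightarrow> g"
  proof (rule LIMSEQ_norm_0[THEN LIM_zero_cancel])
    show "norm (h n - g) < 1 / real (Suc n)" for n by (rule hq(1))
  qed
  have "real n \<le> norm (q n)" for n
    using hq(4)[of n] by simp
  then have qinf: "filterlim (\<lambda>n. norm (q n)) at_top sequentially"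
    by (intro filterlim_at_top_mono[OF filterlim_real_sequentially] always_eventually allI)
  have "\<forall>n. q n /\<^sub>R norm (q n) \<in> sphere 0 1"
    using qpos by (auto simp: less_le)
  with compact_sphere[of "0 :: real ^ 'n" 1]
  obtain d r where d: "d \<in> sphere 0 1" and r: "strict_mono r"
      "((\<lambda>n. q n /\<^sub>R norm (q n)) \<circ> r) \<longlonglongrightarrow> d"
    unfolding compact_eq_seq_compact_metric by (rule seq_compactE)
  have lim: "(\<lambda>n. q (r n) /\<^sub>R norm (q (r n))) \<longlonglongrightarrow> d"
    using r(2) by (simp add: o_def)
  have qrinf: "filterlim (\<lambda>n. norm (q (r n))) at_top sequentially"
    using filterlim_compose[OF qinf filterlim_subseq[OF r(1)]] .
  have "d \<in> asymptotic_cone C"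
    by (rule seq_unbounded_direction_in_asymptotic_cone[OF assms(1,2) _ qrinf lim]) (rule hq(2))
  with d g have "g \<bullet> d > 0"
    unfolding int_dual_cone_def by auto
  moreover have "g \<bullet> d \<le> 0"
  proof (rule LIMSEQ_le)
    show "(\<lambda>n. h (r n) \<bullet> (q (r n) /\<^sub>R norm (q (r n)))) \<longlonglongrightarrow> g \<bullet> d"
      using LIMSEQ_subseq_LIMSEQ[OF hlim r(1)] by (intro tendsto_inner lim) (simp add: o_def)
    show "(\<lambda>n. B / norm (q (r n))) \<longlonglongrightarrow> 0"
      by (rule tendsto_divide_0[OF tendsto_const filterlim_at_top_imp_at_infinity[OF qrinf]])
    show "\<exists>N. \<forall>n\<ge>N. h (r n) \<bullet> (q (r n) /\<^sub>R norm (q (r n))) \<le> B / norm (q (r n))"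
      using hq(3) qpos by (auto simp: divide_simps)
  qed
  ultimately show False by simp
qed

section \<open>Upper and lower quadratic estimates for the objective\<close>

lemma GDERIV_along_line:
  fixes f :: "real ^ 'n \<Rightarrow> real"
  assumes "GDERIV f (z + s *\<^sub>R d) :> g"
  shows "((\<lambda>t. f (z + t *\<^sub>R d)) has_real_derivative g \<bullet> d) (at s)"
proof -
  have f: "(f has_derivative (\<lambda>h. h \<bullet> g)) (at (z + s *\<^sub>R d))"
    using assms by (simp add: gderiv_def)
  have "((\<lambda>t. z + t *\<^sub>R d) has_derivative (\<lambda>t. t *\<^sub>R d)) (at s)"
    by (auto intro!: derivative_eq_intros)
  from has_derivative_compose[OF this f] show ?thesis
    by (simp add: has_field_derivative_def inner_commute mult.commute[of _ "d \<bullet> g"])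
qed

lemma lipschitz_gradient_descent_bound:
  fixes f :: "real ^ 'n \<Rightarrow> real"
  assumes grad: "\<And>w. GDERIV f w :> grad w" and "convex C" and lip: "L-lipschitz_on C grad"
    and z: "z \<in> C" "z + d \<in> C" and s: "0 \<le> s" "s \<le> 1"
  shows "f (z + s *\<^sub>R d) \<le> f z + s * (grad z \<bullet> d) + L / 2 * s\<^sup>2 * (norm d)\<^sup>2"
proof -
  \<comment> \<open>\<open>\<phi>\<close> is the difference between \<open>f\<close> on the segment
    and its quadratic upper model, up to the constant \<open>f z\<close>. Its derivative is
    nonpositive by Cauchy-Schwarz and the Lipschitz bound, which is available because the segment
    stays in \<open>C\<close>.\<close>
  define \<phi> where "\<phi> t = f (z + t *\<^sub>R d) - t * (grad z \<bullet> d) - L / 2 * t\<^sup>2 * (norm d)\<^sup>2" for t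
  have "\<phi> s \<le> \<phi> 0"
  proof (rule DERIV_nonpos_imp_nonincreasing[OF s(1)])
    fix t assume t: "0 \<le> t" "t \<le> s"
    have "(1 - t) *\<^sub>R z + t *\<^sub>R (z + d) \<in> C"
      using t s by (intro convexD[OF \<open>convex C\<close> z]) auto
    then have zt: "z + t *\<^sub>R d \<in> C"
      by (simp add: algebra_simps)
    have "(\<phi> has_real_derivative
        (grad (z + t *\<^sub>R d) - grad z) \<bullet> d - L * t * (norm d)\<^sup>2) (at t)"
      unfolding \<phi>_def inner_diff_left
      by (rule derivative_eq_intros GDERIV_along_line[OF grad] refl | simp)+
    moreover have "(grad (z + t *\<^sub>R d) - grad z) \<bullet> d \<le> L * t * (norm d)\<^sup>2"
    proof -
      have "(grad (z + t *\<^sub>R d) - grad z) \<bullet> d \<le> norm (grad (z + t *\<^sub>R d) - grad z) * norm d"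
        by (rule norm_cauchy_schwarz)
      also have "\<dots> \<le> (L * norm (t *\<^sub>R d)) * norm d"
        using lipschitz_onD[OF lip zt z(1)] by (intro mult_right_mono) (auto simp: dist_norm)
      finally show ?thesis using t by (simp add: power2_eq_square)
    qed
    ultimately show "\<exists>y. (\<phi> has_real_derivative y) (at t) \<and> y \<le> 0"
      by (intro exI conjI) auto
  qed
  then show ?thesis by (simp add: \<phi>_def)
qed

text \<open>Divide the strong convexity inequality by \<open>t\<close> and let \<open>t\<close>
  decrease to 0: the difference quotient becomes the directional derivative. The case
  \<open>M = 0\<close> is the first-order inequality for convex functions.\<close>

lemma strongly_convex_on_gradient_bound:
  fixes f :: "real ^ 'n \<Rightarrow> real"
  assumes sc: "strongly_convex_on M C f" and grad: "GDERIV f z :> g"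
    and z: "z \<in> C" and y: "y \<in> C"
  shows "f z + g \<bullet> (y - z) + M / 2 * (norm (y - z))\<^sup>2 \<le> f y"
proof -
  have "((\<lambda>t. f (z + t *\<^sub>R (y - z))) has_real_derivative g \<bullet> (y - z)) (at 0)"
    by (rule GDERIV_along_line) (use grad in simp)
  then have "((\<lambda>t. (f (z + t *\<^sub>R (y - z)) - f z) / t) \<longlongrightarrow> g \<bullet> (y - z)) (at_right 0)"
    by (auto simp: has_field_derivative_iff intro: tendsto_within_subset)
  moreover have "((\<lambda>t. f y - f z - 1/2 * M * (1 - t) * (norm (y - z))\<^sup>2) \<longlongrightarrow>
      f y - f z - 1/2 * M * (1 - 0) * (norm (y - z))\<^sup>2) (at_right 0)"
    by (intro tendsto_intros)
  moreover have "\<forall>\<^sub>F t in at_right 0. (f (z + t *\<^sub>R (y - z)) - f z) / t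
      \<le> f y - f z - 1/2 * M * (1 - t) * (norm (y - z))\<^sup>2"
    unfolding eventually_at_right_field
  proof (intro exI[of _ "1::real"] conjI allI impI)
    fix t :: real assume t: "0 < t" "t < 1"
    have "f (t *\<^sub>R y + (1 - t) *\<^sub>R z)
        \<le> t * f y + (1 - t) * f z - 1/2 * M * t * (1 - t) * (norm (z - y))\<^sup>2"
      using sc y z t unfolding strongly_convex_on_def by auto
    moreover have "t *\<^sub>R y + (1 - t) *\<^sub>R z = z + t *\<^sub>R (y - z)"
      by (simp add: algebra_simps)
    ultimately have "f (z + t *\<^sub>R (y - z)) - f z
        \<le> (f y - f z - 1/2 * M * (1 - t) * (norm (y - z))\<^sup>2) * t"
      by (simp add: norm_minus_commute algebra_simps)
    then show "(f (z + t *\<^sub>R (y - z)) - f z) / t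
        \<le> f y - f z - 1/2 * M * (1 - t) * (norm (y - z))\<^sup>2"
      using t by (simp add: pos_divide_le_eq)
  qed simp
  ultimately have "g \<bullet> (y - z) \<le> f y - f z - 1/2 * M * (1 - 0) * (norm (y - z))\<^sup>2"
    by (intro tendsto_le[OF trivial_limit_at_right_real])
  then show ?thesis by simp
qed

lemma strongly_convex_on_0_iff:
  assumes "convex C"
  shows "strongly_convex_on 0 C f \<longleftrightarrow> convex_on C f"
proof
  assume "convex_on C f"
  then show "strongly_convex_on 0 C f"
    unfolding strongly_convex_on_def convex_on_def by auto
next
  assume f: "strongly_convex_on 0 C f"
  show "convex_on C f"
  proof (rule convex_onI[OF _ assms])
    fix t :: real and x y assume "0 < t" "t < 1" "x \<in> C" "y \<in> C"
    then show "f ((1 - t) *\<^sub>R x + t *\<^sub>R y) \<le> (1 - t) * f x + t * f y"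
      using f[unfolded strongly_convex_on_def, rule_format, of y x t] by (simp add: add.commute)
  qed
qed

lemma strongly_convex_on_mono:
  assumes "strongly_convex_on M C f" "N \<le> M"
  shows "strongly_convex_on N C f"
  unfolding strongly_convex_on_def
proof (intro ballI)
  fix x y and t :: real assume *: "x \<in> C" "y \<in> C" "t \<in> {0..1}"
  have "1/2 * N * t * (1 - t) * (norm (y - x))\<^sup>2 \<le> 1/2 * M * t * (1 - t) * (norm (y - x))\<^sup>2"
    using * \<open>N \<le> M\<close> by (intro mult_right_mono) auto
  with assms(1)[unfolded strongly_convex_on_def, rule_format, OF *]
  show "f (t *\<^sub>R x + (1 - t) *\<^sub>R y)
      \<le> t * f x + (1 - t) * f y - 1/2 * N * t * (1 - t) * (norm (y - x))\<^sup>2"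
    by linarith
qed

section \<open>Descent and cluster points of Frank-Wolfe runs\<close>

text \<open>With \<open>v\<close> the negated gap and \<open>D = L * (norm (p - z))\<^sup>2\<close>,
  the quadratic upper model at step length \<open>s\<close> is
  \<open>f z - s * v + s\<^sup>2 * D / 2\<close>. The prescribed step is exactly its minimizer over
  the interval from 0 to 1.\<close>

lemma frank_wolfe_step_decrease:
  fixes f :: "real ^ 'n \<Rightarrow> real"
  assumes grad: "\<And>w. GDERIV f w :> grad w" and "convex C" and "L > 0"
    and lip: "L-lipschitz_on C grad" and z: "z \<in> C" and step: "frank_wolfe_step C grad L z z'"
  obtains p where "p \<in> C" "\<And>q. q \<in> C \<Longrightarrow> grad z \<bullet> (p - z) \<le> grad z \<bullet> (q - z)"
    "grad z \<bullet> (p - z) \<le> 0" "z' \<in> C"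
    "f z' \<le> f z - 1/2 * min \<bar>grad z \<bullet> (p - z)\<bar> ((grad z \<bullet> (p - z))\<^sup>2 / (L * (norm (p - z))\<^sup>2))"
proof -
  from step obtain p where p: "minimizer_on C (\<lambda>q. grad z \<bullet> (q - z)) p"
    and v0: "grad z \<bullet> (p - z) \<noteq> 0"
    and z': "z' = z + min 1 (\<bar>grad z \<bullet> (p - z)\<bar> / (L * (norm (p - z))\<^sup>2)) *\<^sub>R (p - z)"
    unfolding frank_wolfe_step_def Let_def by auto
  define v where "v = - (grad z \<bullet> (p - z))"
  define D where "D = L * (norm (p - z))\<^sup>2"
  define s where "s = min 1 (v / D)"
  have pC: "p \<in> C" and pmin: "\<And>q. q \<in> C \<Longrightarrow> grad z \<bullet> (p - z) \<le> grad z \<bullet> (q - z)"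
    using p unfolding minimizer_on_def by auto
  \<comment> \<open>The point \<open>z\<close> itself competes in the linear subproblem with value
    0, and a step that does not stop has a nonzero gap.\<close>
  have v: "v > 0"
    using pmin[OF z] v0 by (simp add: v_def)
  have "p \<noteq> z" using v0 by auto
  then have D: "D > 0" using \<open>L > 0\<close> by (simp add: D_def)
  have s: "0 \<le> s" "s \<le> 1" "s \<le> v / D"
    using v D by (auto simp: s_def)
  have z's: "z' = z + s *\<^sub>R (p - z)"
    using v z' by (simp add: s_def v_def D_def)
  have "(1 - s) *\<^sub>R z + s *\<^sub>R p \<in> C"
    using s by (intro convexD[OF \<open>convex C\<close> z pC]) auto
  then have z'C: "z' \<in> C"
    by (simp add: z's algebra_simps)
  have "f z' \<le> f z + s * (grad z \<bullet> (p - z)) + L / 2 * s\<^sup>2 * (norm (p - z))\<^sup>2"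
    unfolding z's using pC s
    by (intro lipschitz_gradient_descent_bound[OF grad \<open>convex C\<close> lip z]) auto
  also have "\<dots> = f z - s * v + 1/2 * s * (s * D)"
    by (simp add: v_def D_def power2_eq_square)
  \<comment> \<open>Since \<open>s * D \<le> v\<close>, the quadratic loss eats at most half of the
    linear gain \<open>s * v\<close>.\<close>
  also have "\<dots> \<le> f z - s * v + 1/2 * s * v"
    using s D by (intro add_left_mono mult_left_mono) (auto simp: pos_le_divide_eq)
  also have "\<dots> = f z - 1/2 * (s * v)" by simp
  also have "s * v = min v (v\<^sup>2 / D)"
    using v by (simp add: s_def min_mult_distrib_right power2_eq_square)
  finally have "f z' \<le> f z - 1/2 * min \<bar>grad z \<bullet> (p - z)\<bar>
      ((grad z \<bullet> (p - z))\<^sup>2 / (L * (norm (p - z))\<^sup>2))"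
    using v by (simp add: v_def D_def)
  then show thesis
    using that pC pmin v z'C by (simp add: v_def)
qed

lemma frank_wolfe_sequence_descent:
  fixes f :: "real ^ 'n \<Rightarrow> real"
  assumes grad: "\<And>w. GDERIV f w :> grad w" and "convex C" and "L > 0"
    and lip: "L-lipschitz_on C grad" and fw: "frank_wolfe_sequence C grad L x"
  shows "x k \<in> C" and "decseq (\<lambda>k. f (x k))"
proof -
  have step: "frank_wolfe_step C grad L (x k) (x (Suc k))" for k
    using fw by (simp add: frank_wolfe_sequence_def)
  have xC: "x k \<in> C" for k
  proof (induction k)
    case 0
    then show ?case using fw by (simp add: frank_wolfe_sequence_def)
  next
    case (Suc k)
    show ?case
      by (rule frank_wolfe_step_decrease[OF grad \<open>convex C\<close> \<open>L > 0\<close> lip Suc step])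
  qed
  then show "x k \<in> C" .
  show "decseq (\<lambda>k. f (x k))"
  proof (rule decseq_SucI)
    fix k
    obtain p where le: "f (x (Suc k)) \<le> f (x k) - 1/2 * min \<bar>grad (x k) \<bullet> (p - x k)\<bar>
        ((grad (x k) \<bullet> (p - x k))\<^sup>2 / (L * (norm (p - x k))\<^sup>2))"
      by (rule frank_wolfe_step_decrease[OF grad \<open>convex C\<close> \<open>L > 0\<close> lip xC step])
    have "0 \<le> min \<bar>grad (x k) \<bullet> (p - x k)\<bar>
        ((grad (x k) \<bullet> (p - x k))\<^sup>2 / (L * (norm (p - x k))\<^sup>2))"
      using \<open>L > 0\<close> by simp
    with le show "f (x (Suc k)) \<le> f (x k)" by linarith
  qed
qed

text \<open>Convexity is phrased as \<open>strongly_convex_on 0\<close> so that the convex and the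
  strongly convex case share this lemma. The second conclusion concerns the whole sequence of
  values, which is what later yields convergence of the whole run.\<close>

lemma frank_wolfe_cluster_point:
  fixes f :: "real ^ 'n \<Rightarrow> real"
  assumes "closed C" "convex C" and grad: "\<And>w. GDERIV f w :> grad w"
    and cont: "continuous_on UNIV grad" and "L > 0" and lip: "L-lipschitz_on C grad"
    and dual: "\<And>z. z \<in> C \<Longrightarrow> grad z \<in> int_dual_cone (asymptotic_cone C)"
    and fw: "frank_wolfe_sequence C grad L x" and f: "strongly_convex_on 0 C f"
    and a: "cluster_point x a"
  shows "minimizer_on C f a" and "(\<lambda>k. f (x k)) \<longlonglongrightarrow> f a"
proof -
  note descent = frank_wolfe_sequence_descent[OF grad \<open>convex C\<close> \<open>L > 0\<close> lip fw]
  note xC = descent(1) and fdec = descent(2)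
  have "\<exists>p. p \<in> C \<and> (\<forall>q\<in>C. grad (x k) \<bullet> (p - x k) \<le> grad (x k) \<bullet> (q - x k)) \<and>
      grad (x k) \<bullet> (p - x k) \<le> 0 \<and>
      f (x (Suc k)) \<le> f (x k) - 1/2 * min \<bar>grad (x k) \<bullet> (p - x k)\<bar>
        ((grad (x k) \<bullet> (p - x k))\<^sup>2 / (L * (norm (p - x k))\<^sup>2))" for k
    using fw frank_wolfe_step_decrease[OF grad \<open>convex C\<close> \<open>L > 0\<close> lip xC, of k "x (Suc k)"]
    by (metis frank_wolfe_sequence_def)
  then obtain p where pC: "\<And>k. p k \<in> C"
    and pmin: "\<And>k q. q \<in> C \<Longrightarrow> grad (x k) \<bullet> (p k - x k) \<le> grad (x k) \<bullet> (q - x k)"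
    and pneg: "\<And>k. grad (x k) \<bullet> (p k - x k) \<le> 0"
    and dec: "\<And>k. f (x (Suc k)) \<le> f (x k) - 1/2 * min \<bar>grad (x k) \<bullet> (p k - x k)\<bar>
        ((grad (x k) \<bullet> (p k - x k))\<^sup>2 / (L * (norm (p k - x k))\<^sup>2))"
    by metis
  obtain r where r: "strict_mono r" and "(x \<circ> r) \<longlonglongrightarrow> a"
    using a unfolding cluster_point_def by auto
  then have xr: "(\<lambda>n. x (r n)) \<longlonglongrightarrow> a" by (simp add: o_def)
  have aC: "a \<in> C"
    using closed_sequentially[OF \<open>closed C\<close> _ xr] xC by simp
  have gr: "(\<lambda>n. grad (x (r n))) \<longlonglongrightarrow> grad a"
    using cont xr by (auto intro: isCont_tendsto_compose simp: continuous_on_eq_continuous_at)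
  have fa: "(\<lambda>n. f (x (r n))) \<longlonglongrightarrow> f a"
  proof (rule isCont_tendsto_compose[OF _ xr])
    show "isCont f a"
      using grad[of a] has_derivative_continuous unfolding gderiv_def by blast
  qed
  define v where "v k = - (grad (x k) \<bullet> (p k - x k))" for k
  have v: "v k \<ge> 0" for k
    using pneg by (simp add: v_def)
  have dec': "f (x (Suc k)) \<le> f (x k) - 1/2 * min (v k) ((v k)\<^sup>2 / (L * (norm (p k - x k))\<^sup>2))" for k
    using dec[of k] pneg[of k] by (simp add: v_def)
  have fr: "f a \<le> f (x (r n))" for n
    using decseq_ge[OF _ fa] fdec strict_mono_less_eq[OF r] by (auto simp: decseq_def)
  \<comment> \<open>As \<open>k \<le> r k\<close>, monotonicity puts \<open>f (x k)\<close> above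
    \<open>f (x (r k))\<close>.\<close>
  have fge: "f a \<le> f (x k)" for k
    using fr[of k] decseqD[OF fdec seq_suble[OF r, of k]] by linarith
  show f_lim: "(\<lambda>k. f (x k)) \<longlonglongrightarrow> f a"
  proof (rule decseq_convergent[OF fdec, of "f a"])
    show "\<forall>i. f a \<le> f (x i)" using fge by blast
    fix l assume l: "(\<lambda>k. f (x k)) \<longlonglongrightarrow> l"
    have "(\<lambda>n. f (x (r n))) \<longlonglongrightarrow> l"
      using LIMSEQ_subseq_LIMSEQ[OF l r] by (simp add: o_def)
    then show "(\<lambda>k. f (x k)) \<longlonglongrightarrow> f a"
      using l LIMSEQ_unique[OF fa] by simp
  qed
  have "Bseq (\<lambda>n. x (r n))"
    using xr by (intro convergent_imp_Bseq convergentI)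
  then obtain X where X: "\<And>n. norm (x (r n)) \<le> X"
    unfolding Bseq_def by blast
  \<comment> \<open>The cluster point \<open>a\<close> is a competitor in every linear subproblem,
    so \<open>B\<close> also bounds the minimal values
    \<open>grad (x (r n)) \<bullet> p (r n)\<close> from above. This puts the points
    \<open>p (r n)\<close> into linear sublevel sets at the fixed height \<open>B\<close>.\<close>
  have "convergent (\<lambda>n. grad (x (r n)) \<bullet> a)"
    by (rule convergentI[OF tendsto_inner[OF gr tendsto_const]])
  from convergent_imp_Bseq[OF this]
  obtain B where B: "\<And>n. norm (grad (x (r n)) \<bullet> a) \<le> B"
    unfolding Bseq_def by blast
  obtain e D where e: "e > 0"
    and D: "\<And>h q. norm (h - grad a) < e \<Longrightarrow> q \<in> C \<Longrightarrow> h \<bullet> q \<le> B \<Longrightarrow> norm q \<le> D"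
    using int_dual_cone_sublevel_bounded[OF assms(1,2) dual[OF aC], of B] by blast
  have gnear: "\<forall>\<^sub>F n in sequentially. norm (grad (x (r n)) - grad a) < e"
    using tendstoD[OF gr e] by (simp add: dist_norm)
  have pbound: "\<forall>\<^sub>F n in sequentially. norm (p (r n) - x (r n)) \<le> D + X"
    using gnear
  proof eventually_elim
    case (elim n)
    have "grad (x (r n)) \<bullet> p (r n) \<le> grad (x (r n)) \<bullet> a"
      using pmin[OF aC, of "r n"] by (simp add: inner_diff_right)
    also have "\<dots> \<le> B" using B[of n] by simp
    finally have "norm (p (r n)) \<le> D"
      using D[OF elim pC] by simp
    then show ?case
      using norm_triangle_ineq4[of "p (r n)" "x (r n)"] X[of n] by linarith
  qed
  \<comment> \<open>No sign of \<open>D\<close> is known beforehand; it follows because some norm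
    lies below \<open>D + X\<close>.\<close>
  have D0: "D + X \<ge> 0"
    using pbound by (auto simp: eventually_sequentially intro: order_trans[OF norm_ge_zero])
  have vlim: "(\<lambda>n. v (r n)) \<longlonglongrightarrow> 0"
  proof (rule LIMSEQ_I)
    fix \<epsilon> :: real assume \<epsilon>: "\<epsilon> > 0"
    \<comment> \<open>\<open>K\<close> dominates
      \<open>L * (norm (p (r n) - x (r n)))\<^sup>2\<close> for late \<open>n\<close>, and the added
      1 makes it positive even if \<open>D + X = 0\<close>. A gap of at least \<epsilon> would then
      cost a decrease of at least \<open>\<delta> / 2\<close>.\<close>
    define K where "K = L * (D + X + 1)\<^sup>2"
    have K: "K > 0" using D0 \<open>L > 0\<close> by (simp add: K_def)
    define \<delta> where "\<delta> = min \<epsilon> (\<epsilon>\<^sup>2 / K)"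
    have "\<delta> / 2 > 0" using \<epsilon> K by (simp add: \<delta>_def)
    \<comment> \<open>The successor is taken in the full run, not in the subsequence, so convergence
      of all values \<open>f (x k)\<close> is used here.\<close>
    have "(\<lambda>n. f (x (r n)) - f (x (Suc (r n)))) \<longlonglongrightarrow> f a - f a"
      using LIMSEQ_subseq_LIMSEQ[OF f_lim r] LIMSEQ_subseq_LIMSEQ[OF LIMSEQ_Suc[OF f_lim] r]
      by (intro tendsto_diff) (simp_all add: o_def)
    from order_tendstoD(2)[OF this, of "\<delta> / 2"] \<open>\<delta> / 2 > 0\<close>
    have "\<forall>\<^sub>F n in sequentially. f (x (r n)) - f (x (Suc (r n))) < \<delta> / 2" by simp
    with pbound have "\<forall>\<^sub>F n in sequentially. v (r n) < \<epsilon>"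
    proof eventually_elim
      case (elim n)
      show ?case
      proof (rule ccontr)
        assume "\<not> v (r n) < \<epsilon>"
        then have ve: "\<epsilon> \<le> v (r n)" by simp
        \<comment> \<open>This keeps the denominator in the decrease bound positive; otherwise
          division by zero would make that quotient 0.\<close>
        then have ne: "p (r n) - x (r n) \<noteq> 0" using \<epsilon> by (auto simp: v_def)
        have "norm (p (r n) - x (r n)) \<le> D + X + 1"
          using elim(1) by simp
        then have "\<epsilon>\<^sup>2 / K \<le> (v (r n))\<^sup>2 / (L * (norm (p (r n) - x (r n)))\<^sup>2)"
          using ve \<epsilon> \<open>L > 0\<close> ne unfolding K_def by (intro frac_le power_mono mult_left_mono) auto
        with ve have "\<delta> \<le> min (v (r n)) ((v (r n))\<^sup>2 / (L * (norm (p (r n) - x (r n)))\<^sup>2))"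
          unfolding \<delta>_def by linarith
        with dec'[of "r n"] elim(2) show False by linarith
      qed
    qed
    then show "\<exists>N. \<forall>n\<ge>N. norm (v (r n) - 0) < \<epsilon>"
      using v by (simp add: eventually_sequentially)
  qed
  show "minimizer_on C f a"
    unfolding minimizer_on_def
  proof (intro conjI aC ballI)
    fix y assume y: "y \<in> C"
    \<comment> \<open>The minimality of \<open>p (r n)\<close>, tested against \<open>y\<close>,
      passes to the limit and becomes the variational inequality at \<open>a\<close>.\<close>
    have "- 0 \<le> grad a \<bullet> (y - a)"
    proof (rule LIMSEQ_le)
      show "(\<lambda>n. - v (r n)) \<longlonglongrightarrow> - 0" by (intro tendsto_minus vlim)
      show "(\<lambda>n. grad (x (r n)) \<bullet> (y - x (r n))) \<longlonglongrightarrow> grad a \<bullet> (y - a)"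
        by (intro tendsto_intros gr xr)
      show "\<exists>N. \<forall>n\<ge>N. - v (r n) \<le> grad (x (r n)) \<bullet> (y - x (r n))"
        using pmin[OF y] by (simp add: v_def)
    qed
    with strongly_convex_on_gradient_bound[OF f grad aC y] show "f a \<le> f y" by simp
  qed
qed

section \<open>Strong convexity: error bound, bounded sublevel sets and convergence\<close>

text \<open>Points on the segment from \<open>a\<close> towards \<open>z\<close> have values at
  least \<open>f a\<close>. Comparing this with strong convexity, dividing by \<open>t\<close> and
  letting \<open>t\<close> decrease to 0 gives quadratic growth with the full constant
  \<open>M / 2\<close>.\<close>

lemma strongly_convex_on_minimizer_bound:
  fixes f :: "real ^ 'n \<Rightarrow> real"
  assumes "M > 0" and f: "strongly_convex_on M C f" and "convex C"
    and a: "minimizer_on C f a" and z: "z \<in> C"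
  shows "norm (z - a) \<le> sqrt (2 * (f z - f a) / M)"
proof -
  have aC: "a \<in> C" using a by (simp add: minimizer_on_def)
  have lim: "((\<lambda>t. 1/2 * M * (1 - t) * (norm (z - a))\<^sup>2) \<longlongrightarrow>
      1/2 * M * (1 - 0) * (norm (z - a))\<^sup>2) (at_right 0)"
    by (intro tendsto_intros)
  have "\<forall>\<^sub>F t in at_right 0. 1/2 * M * (1 - t) * (norm (z - a))\<^sup>2 \<le> f z - f a"
    unfolding eventually_at_right_field
  proof (intro exI[of _ "1::real"] conjI allI impI)
    fix t :: real assume t: "0 < t" "t < 1"
    have "t *\<^sub>R z + (1 - t) *\<^sub>R a \<in> C"
      using t by (intro convexD[OF \<open>convex C\<close> z aC]) auto
    then have "f a \<le> f (t *\<^sub>R z + (1 - t) *\<^sub>R a)"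
      using a by (simp add: minimizer_on_def)
    also have "\<dots> \<le> t * f z + (1 - t) * f a - 1/2 * M * t * (1 - t) * (norm (a - z))\<^sup>2"
      using f z aC t unfolding strongly_convex_on_def by auto
    finally have "t * (1/2 * M * (1 - t) * (norm (z - a))\<^sup>2) \<le> t * (f z - f a)"
      by (simp add: norm_minus_commute algebra_simps)
    then show "1/2 * M * (1 - t) * (norm (z - a))\<^sup>2 \<le> f z - f a"
      using t by simp
  qed simp
  then have "1/2 * M * (1 - 0) * (norm (z - a))\<^sup>2 \<le> f z - f a"
    by (intro tendsto_upperbound[OF lim] trivial_limit_at_right_real)
  then have "(norm (z - a))\<^sup>2 \<le> 2 * (f z - f a) / M"
    using \<open>M > 0\<close> by (simp add: field_simps)
  then show ?thesis by (rule real_le_rsqrt)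
qed

text \<open>At distance \<open>r\<close> from \<open>z\<close> the quadratic gain
  \<open>M / 2 * r\<^sup>2\<close> must be compensated by a linear loss of at most
  \<open>norm g * r\<close>, so \<open>r\<close> is at most \<open>2 * norm g / M\<close>.\<close>

lemma strongly_convex_on_sublevel_bounded:
  fixes f :: "real ^ 'n \<Rightarrow> real"
  assumes "M > 0" and f: "strongly_convex_on M C f" and grad: "GDERIV f z :> g" and z: "z \<in> C"
  shows "bounded {y \<in> C. f y \<le> f z}"
proof (rule bounded_subset[OF bounded_cball])
  show "{y \<in> C. f y \<le> f z} \<subseteq> cball z (2 * norm g / M)"
  proof safe
    fix y assume y: "y \<in> C" "f y \<le> f z"
    have "M / 2 * (norm (y - z))\<^sup>2 \<le> - (g \<bullet> (y - z))"
      using strongly_convex_on_gradient_bound[OF f grad z y(1)] y(2) by simp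
    also have "\<dots> \<le> norm g * norm (y - z)"
      using norm_cauchy_schwarz[of "- g" "y - z"] by simp
    finally have "norm (y - z) * (M / 2 * norm (y - z)) \<le> norm (y - z) * norm g"
      by (simp add: power2_eq_square mult_ac)
    then have "y = z \<or> M / 2 * norm (y - z) \<le> norm g"
      by (subst (asm) mult_le_cancel_left) auto
    then show "y \<in> cball z (2 * norm g / M)"
      using \<open>M > 0\<close> by (auto simp: dist_norm norm_minus_commute field_simps)
  qed
qed

theorem theorem3p6:
  fixes C :: "(real ^ 'n) set"
    and f :: "real ^ 'n \<Rightarrow> real"
    and grad :: "real ^ 'n \<Rightarrow> real ^ 'n"
    and L :: real
    and x :: "nat \<Rightarrow> real ^ 'n"
  assumes "closed C" and "convex C"
    and "\<And>z. GDERIV f z :> grad z"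
    and "continuous_on UNIV grad"
    and "L > 0" and "L-lipschitz_on C grad"
    and "\<And>z. z \<in> C \<Longrightarrow> grad z \<in> int_dual_cone (asymptotic_cone C)"
    and "frank_wolfe_sequence C grad L x"
  shows "(convex_on C f \<longrightarrow> (\<forall>a. cluster_point x a \<longrightarrow> minimizer_on C f a)) \<and>
    (\<forall>M>0. strongly_convex_on M C f \<longrightarrow>
       (\<exists>a. x \<longlonglongrightarrow> a \<and> minimizer_on C f a \<and>
            (\<forall>k. norm (x k - a) \<le> sqrt (2 * (f (x k) - f a) / M))))"
proof -
  have part1: "minimizer_on C f a" "(\<lambda>k. f (x k)) \<longlonglongrightarrow> f a"
    if "strongly_convex_on 0 C f" "cluster_point x a" for a
    using frank_wolfe_cluster_point[OF assms that] by blast+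
  have "\<exists>a. x \<longlonglongrightarrow> a \<and> minimizer_on C f a \<and>
      (\<forall>k. norm (x k - a) \<le> sqrt (2 * (f (x k) - f a) / M))"
    if M: "M > 0" and sc: "strongly_convex_on M C f" for M
  proof -
    have xC: "x k \<in> C" and fx: "f (x k) \<le> f (x 0)" for k
      using frank_wolfe_sequence_descent[OF assms(3,2,5,6,8)] by (auto simp: decseq_def)
    \<comment> \<open>Descent confines the run to the sublevel set of its starting point.\<close>
    have "bounded (range x)"
      using strongly_convex_on_sublevel_bounded[OF M sc assms(3) xC[of 0]]
      by (rule bounded_subset) (use xC fx in auto)
    then obtain a r where "strict_mono r" "(x \<circ> r) \<longlonglongrightarrow> a"
      using bounded_imp_convergent_subsequence by blast
    then have "cluster_point x a"
      by (auto simp: cluster_point_def)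
    moreover have "strongly_convex_on 0 C f"
      using strongly_convex_on_mono[OF sc] M by simp
    ultimately have a: "minimizer_on C f a" and f_lim: "(\<lambda>k. f (x k)) \<longlonglongrightarrow> f a"
      using part1 by blast+
    have bound: "norm (x k - a) \<le> sqrt (2 * (f (x k) - f a) / M)" for k
      by (rule strongly_convex_on_minimizer_bound[OF M sc \<open>convex C\<close> a xC])
    have "(\<lambda>k. sqrt (2 * (f (x k) - f a) / M)) \<longlonglongrightarrow> sqrt (2 * (f a - f a) / M)"
      using M by (intro tendsto_intros f_lim) auto
    then have "(\<lambda>k. sqrt (2 * (f (x k) - f a) / M)) \<longlonglongrightarrow> 0"
      by simp
    \<comment> \<open>The error bound squeezes the distance to \<open>a\<close>, so convergence of
      the values forces convergence of the points.\<close>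
    then have "(\<lambda>k. x k - a) \<longlonglongrightarrow> 0"
      by (rule tendsto_0_le[of _ _ _ 1]) (use order_trans[OF bound abs_ge_self] in auto)
    then have "x \<longlonglongrightarrow> a"
      by (rule LIM_zero_cancel)
    with a bound show ?thesis by blast
  qed
  then show ?thesis
    using part1(1) strongly_convex_on_0_iff[OF \<open>convex C\<close>] by blast
qed

end
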